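(* As formal power series, \[ A_{\{1,2\}}(x,y) = \frac{1-x}{(1-xy-x^2y^2)(1-x) - 2x^2y}, \] and for any integer $c \geq 1$, $A_{\{c,2c\}}(x,y) = A_{\{1,2\}}(x^c,y^c)$.
   Context: A composition of $n$ is an ordered list of positive integers (parts) with sum $n$; the empty list is the unique composition of $0$. A meander on $n$ nodes is a pair $\frac{\lambda}{\mu}$ of compositions of $n$, viewed as a planar (multi)graph on vertices $1,\dots,n$: for each part $a$ of $\lambda$, occupying the consecutive vertices $p+1,\dots,p+a$ (where $p$ is the sum of the preceding parts), there is an upper edge joining $p+i$ and $p+a+1-i$ for each $1\le i\le \lfloor a/2\rfloor$; lower edges are defined in the same way from $\mu$. If the same two vertices are joined by both an upper and a lower edge, both edges are kept and form a cycle. Every connected component is a cycle or a path (an isolated vertex counts as a path). The index is $\operatorname{ind}(\frac{\lambda}{\mu}) = 2c+p$, where here $c$ is the number of cycles and $p$ is the number of paths (this equals the index of the associated seaweed subalgebra of $\mathfrak{gl}_n$). For a set $J$ of positive integers, $a^J_{n,k}$ is the number of meanders $\frac{\lambda}{\mu}$ on $n$ nodes of index $k$ such that all parts of $\lambda$ and $\mu$ lie in $J$, and $A_J(x,y)=\sum_{n,k\ge 0} a^J_{n,k}x^ny^k$ (the empty meander gives $a^J_{0,0}=1$). *)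

theory Defs
  imports "HOL-Computational_Algebra.Formal_Laurent_Series"
begin

section \<open>Finite multigraphs: connected components, paths and cycles\<close>

text \<open>
  An undirected multigraph is given by a vertex set \<open>V\<close>, a set \<open>E\<close> of edge names and a map
  \<open>ends\<close> sending an edge name to its set of end points; parallel edges are different names
  with the same ends.
\<close>

definition adjacency :: "'e set \<Rightarrow> ('e \<Rightarrow> 'v set) \<Rightarrow> ('v \<times> 'v) set" where
  "adjacency E ends = {(u, v). \<exists>e\<in>E. ends e = {u, v}}"

definition components :: "'v set \<Rightarrow> 'e set \<Rightarrow> ('e \<Rightarrow> 'v set) \<Rightarrow> 'v set set" where
  "components V E ends = V // ((adjacency E ends)\<^sup>* \<inter> V \<times> V)"

definition edges_within :: "'e set \<Rightarrow> ('e \<Rightarrow> 'v set) \<Rightarrow> 'v set \<Rightarrow> 'e set" where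
  "edges_within E ends C = {e \<in> E. ends e \<subseteq> C}"

text \<open>
  In the next two definitions the vertices and the edges of the component are listed in the
  order in which they are traversed, each exactly once. A path may be a single vertex without
  edges; a cycle may consist of two vertices joined by two parallel edges.
\<close>

definition is_path :: "'e set \<Rightarrow> ('e \<Rightarrow> 'v set) \<Rightarrow> 'v set \<Rightarrow> bool" where
  "is_path E ends C \<longleftrightarrow>
     (\<exists>vs es. distinct vs \<and> set vs = C \<and>
              distinct es \<and> set es = edges_within E ends C \<and>
              length vs = length es + 1 \<and>
              (\<forall>i < length es. ends (es ! i) = {vs ! i, vs ! (i + 1)}))"

definition is_cycle :: "'e set \<Rightarrow> ('e \<Rightarrow> 'v set) \<Rightarrow> 'v set \<Rightarrow> bool" where
  "is_cycle E ends C \<longleftrightarrow>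
     (\<exists>vs es. vs \<noteq> [] \<and> distinct vs \<and> set vs = C \<and>
              distinct es \<and> set es = edges_within E ends C \<and>
              length vs = length es \<and>
              (\<forall>i < length es. ends (es ! i) = {vs ! i, vs ! ((i + 1) mod length vs)}))"


section \<open>Meanders and their index\<close>

definition compositions :: "nat \<Rightarrow> nat list set" where
  "compositions n = {xs. (\<forall>a \<in> set xs. 0 < a) \<and> sum_list xs = n}"

definition meanders :: "nat \<Rightarrow> (nat list \<times> nat list) set" where
  "meanders n = compositions n \<times> compositions n"

definition arcs :: "nat list \<Rightarrow> nat set set" where
  "arcs xs = {{p + i, p + a + 1 - i} | p a i.
     \<exists>j < length xs. p = sum_list (take j xs) \<and> a = xs ! j \<and> 1 \<le> i \<and> i \<le> a div 2}"

datatype side = Upper | Lower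

fun meander_verts :: "nat list \<times> nat list \<Rightarrow> nat set" where
  "meander_verts (lam, mu) = {1..sum_list lam}"

fun meander_edges :: "nat list \<times> nat list \<Rightarrow> (side \<times> nat set) set" where
  "meander_edges (lam, mu) = {Upper} \<times> arcs lam \<union> {Lower} \<times> arcs mu"

definition meander_components :: "nat list \<times> nat list \<Rightarrow> nat set set" where
  "meander_components m = components (meander_verts m) (meander_edges m) snd"

definition meander_index :: "nat list \<times> nat list \<Rightarrow> nat" where
  "meander_index m =
     2 * card {C \<in> meander_components m. is_cycle (meander_edges m) snd C} +
     card {C \<in> meander_components m. is_path (meander_edges m) snd C}"

definition meander_count :: "nat set \<Rightarrow> nat \<Rightarrow> nat \<Rightarrow> nat" where
  "meander_count J n k =
     card {(lam, mu) \<in> meanders n.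
             set lam \<subseteq> J \<and> set mu \<subseteq> J \<and> meander_index (lam, mu) = k}"


section \<open>Bivariate generating functions\<close>

text \<open>
  Power series in \<open>x\<close> and \<open>y\<close> are power series in \<open>x\<close> whose coefficients are power series in \<open>y\<close>.
  The scalars are rational because the library's division of power series needs \<open>inverse\<close>
  on the scalars.
\<close>

abbreviation var_x :: "rat fps fps" where
  "var_x \<equiv> fps_X"

abbreviation var_y :: "rat fps fps" where
  "var_y \<equiv> fps_const fps_X"

definition meander_gf :: "nat set \<Rightarrow> rat fps fps" where
  "meander_gf J = Abs_fps (\<lambda>n. Abs_fps (\<lambda>k. of_nat (meander_count J n k)))"

text \<open>
  \<open>subst_powers c F\<close> is \<open>F(x\<^sup>c, y\<^sup>c)\<close>: \<open>y\<^sup>c\<close> is substituted in every coefficient, then \<open>x\<^sup>c\<close> in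
  the outer series. Composition of power series is meaningful here only for \<open>c \<ge> 1\<close>.
\<close>

definition subst_powers :: "nat \<Rightarrow> rat fps fps \<Rightarrow> rat fps fps" where
  "subst_powers c F = Abs_fps (\<lambda>n. fps_nth F n oo fps_X ^ c) oo fps_X ^ c"

lemma subst_powers_nth:
  assumes "c \<ge> 1"
  shows "fps_nth (fps_nth (subst_powers c F) n) k =
           (if c dvd n \<and> c dvd k then fps_nth (fps_nth F (n div c)) (k div c) else 0)"
  using assms by (simp add: subst_powers_def fps_nth_compose_X_power)

text \<open>
  The coefficient ring \<open>rat fps\<close> is not a field, but division by a series with constant
  term 1 is the genuine quotient.
\<close>

lemma fps_fps_divide_mult_cancel:
  fixes F G :: "rat fps fps"
  assumes "fps_nth G 0 = 1"
  shows "F / G * G = F"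
proof -
  have "G * inverse G = 1"
    unfolding fps_inverse_def using assms by (intro fps_right_inverse) simp
  moreover have "F / G = F * inverse G"
    using assms by (simp add: fps_divide_unit)
  ultimately show ?thesis
    by (simp add: mult.assoc mult.commute)
qed

end

theory Submission
  imports Defs
begin

text \<open>
  The upper and the lower arcs of a meander are given by two involutions of the vertices. The walk
  that applies them alternately shows that every component is a path or a cycle, so that the number
  of vertices minus the number of edges is the number of paths, and
  index = 2 * (number of components) + (number of edges) - (number of vertices).

  With all blocks of size \<open>c\<close> or \<open>2c\<close> the components can be counted by peeling off leftmost blocks.
  Two equal blocks of size \<open>a\<close> contribute \<open>a\<close> to the index. If the leftmost blocks are \<open>c\<close> and \<open>2c\<close>,
  the first \<open>c\<close> vertices can be folded onto the next \<open>c\<close> vertices, which deletes the block \<open>c\<close> and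
  replaces \<open>2c\<close> by \<open>c\<close> without changing the index. This reduction is homogeneous in \<open>c\<close>, hence the
  substitution rule. For \<open>c = 1\<close>, let \<open>F\<close> be the generating function of the meanders and \<open>G\<close> that of
  the states reached after one folding step. Then \<open>F = 1 + x y F + x\<^sup>2 y\<^sup>2 F + 2 x\<^sup>2 G\<close> and
  \<open>G = y F + x G\<close>.
\<close>

section \<open>Alternating walks of two involutions\<close>

fun opp :: "side \<Rightarrow> side" where
  "opp Upper = Lower"
| "opp Lower = Upper"

lemma opp_opp [simp]: "opp (opp s) = s"
  by (cases s) auto

lemma opp_neq [simp]: "opp s \<noteq> s" "s \<noteq> opp s"
  by (cases s; simp)+

lemma neq_imp_opp: "t \<noteq> s \<Longrightarrow> t = opp s"
  by (cases s; cases t) auto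

text \<open>The side taken by step \<open>k\<close> of an alternating walk whose first step is on
  side \<open>s\<close>.\<close>

definition turn :: "side \<Rightarrow> nat \<Rightarrow> side" where
  "turn s k = (if even k then s else opp s)"

lemma turn_Suc: "turn s (Suc k) = opp (turn s k)"
  by (simp add: turn_def)

lemma turn_0 [simp]: "turn s 0 = s"
  by (simp add: turn_def)

lemma equiv_rtrancl:
  assumes "sym r"
  shows "equiv V (r\<^sup>* \<inter> V \<times> V)"
  using sym_rtrancl[OF assms] trans_rtrancl[of r]
  by (intro equivI refl_onI symI transI) (auto dest: symD transD)

locale two_involutions =
  fixes V :: "'v set" and f :: "side \<Rightarrow> 'v \<Rightarrow> 'v"
  assumes finite_V: "finite V"
    and closed: "x \<in> V \<Longrightarrow> f s x \<in> V"
    and invol: "x \<in> V \<Longrightarrow> f s (f s x) = x"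
begin

text \<open>A fixed point of \<open>f s\<close> is a vertex without an edge on side
  \<open>s\<close>. Edge names carry the side, so edges with the same ends on different sides stay
  distinct.\<close>

definition edges :: "(side \<times> 'v set) set" where
  "edges = {(s, {x, f s x}) | s x. x \<in> V \<and> f s x \<noteq> x}"

lemma adjacency_edges: "adjacency edges snd = {(u, f s u) | u s. u \<in> V \<and> f s u \<noteq> u}"
  unfolding adjacency_def edges_def
  by (auto simp: doubleton_eq_iff) (metis closed invol)+

lemma step_connected: "x \<in> V \<Longrightarrow> (x, f s x) \<in> (adjacency edges snd)\<^sup>*"
  by (cases "f s x = x") (auto simp: adjacency_edges)

lemma equiv_connected: "equiv V ((adjacency edges snd)\<^sup>* \<inter> V \<times> V)"
  by (intro equiv_rtrancl symI) (auto simp: adjacency_def insert_commute)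

primrec walk :: "side \<Rightarrow> 'v \<Rightarrow> nat \<Rightarrow> 'v" where
  "walk s v 0 = v"
| "walk s v (Suc k) = f (turn s k) (walk s v k)"

lemma walk_in_V: "v \<in> V \<Longrightarrow> walk s v k \<in> V"
  by (induction k) (auto intro: closed)

lemma walk_back: "v \<in> V \<Longrightarrow> f (turn s k) (walk s v (Suc k)) = walk s v k"
  by (simp add: invol walk_in_V)

lemma walk_connected: "v \<in> V \<Longrightarrow> (v, walk s v k) \<in> (adjacency edges snd)\<^sup>*"
  by (induction k) (auto intro: rtrancl_trans step_connected walk_in_V)

text \<open>The walk arrived at this vertex on side \<open>turn s k\<close>, so that involution
  leads back, and the other one is the next step.\<close>

lemma step_walk_Suc:
  assumes "v \<in> V"
  shows "f t (walk s v (Suc k)) = (if t = turn s k then walk s v k else walk s v (Suc (Suc k)))"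
proof (cases "t = turn s k")
  case True
  then show ?thesis by (simp only: walk_back[OF assms] refl if_True)
next
  case False
  then have "t = turn s (Suc k)" by (simp add: turn_Suc neq_imp_opp)
  then show ?thesis using False by simp
qed

text \<open>
  The first repeated vertex of an alternating walk cannot lie strictly inside: both its neighbours
  have already been visited.
\<close>

lemma first_return:
  assumes "v \<in> V"
  obtains j m where "j < m" "inj_on (walk s v) {..<m}" "walk s v m = walk s v j"
    "j = 0 \<or> Suc j = m"
proof -
  let ?w = "walk s v"
  have "\<not> inj ?w"
    using finite_subset[of "range ?w" V] finite_V walk_in_V[OF assms] finite_imageD[of ?w UNIV]
    by auto
  then have ex: "\<exists>m. \<exists>j<m. ?w m = ?w j"
    unfolding inj_def by (metis linorder_neqE_nat)
  define m where "m = (LEAST m. \<exists>j<m. ?w m = ?w j)"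
  obtain j where j: "j < m" "?w m = ?w j"
    using LeastI_ex[OF ex] unfolding m_def by blast
  have inj: "inj_on ?w {..<m}"
  proof (rule inj_onI)
    fix a b assume "a \<in> {..<m}" "b \<in> {..<m}" "?w a = ?w b"
    then show "a = b"
      using not_less_Least[of a "\<lambda>m. \<exists>j<m. ?w m = ?w j"] not_less_Least[of b "\<lambda>m. \<exists>j<m. ?w m = ?w j"]
      unfolding m_def[symmetric] by (metis lessThan_iff linorder_neqE_nat)
  qed
  have "j = 0 \<or> Suc j = m"
  proof (rule ccontr)
    assume "\<not> ?thesis"
    then obtain i where i: "j = Suc i" "Suc j < m"
      using j(1) by (metis Suc_lessI not0_implies_Suc)
    obtain k where k: "m = Suc k" using j(1) by (cases m) auto
    \<comment> \<open>The step into \<open>?w m\<close> is undone at \<open>?w j\<close>, whose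
      neighbours are \<open>?w i\<close> and \<open>?w (Suc j)\<close>. Injectivity leaves
      \<open>k = i\<close>, excluded by \<open>Suc j < m\<close>, or \<open>k = i + 2\<close>,
      excluded because then steps \<open>k\<close> and \<open>i\<close> are on the same
      side.\<close>
    have "?w k = f (turn s k) (?w (Suc i))"
      using walk_back[OF assms, of s k] j(2) i(1) k by simp
    also have "\<dots> = (if turn s k = turn s i then ?w i else ?w (Suc j))"
      by (simp only: step_walk_Suc[OF assms] i(1))
    finally have "k = (if turn s k = turn s i then i else Suc j)"
      using inj i k by (auto simp: inj_on_def split: if_splits)
    then show False using i k by (auto simp: turn_Suc split: if_splits)
  qed
  with j inj show ?thesis using that by blast
qed

lemma component_eq_class:
  assumes "C \<in> components V edges snd" and "v \<in> C"
  shows "C = ((adjacency edges snd)\<^sup>* \<inter> V \<times> V) `` {v}"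
proof -
  obtain u where u: "C = ((adjacency edges snd)\<^sup>* \<inter> V \<times> V) `` {u}"
    using assms(1) unfolding components_def by (rule quotientE)
  then have "(u, v) \<in> (adjacency edges snd)\<^sup>* \<inter> V \<times> V"
    using assms(2) by simp
  then show ?thesis
    unfolding u by (rule equiv_class_eq[OF equiv_connected])
qed

text \<open>An initial segment of the walk that both involutions map into itself absorbs everything
  reachable from \<open>v\<close>; conversely all its vertices are reachable.\<close>

lemma component_eq_walk:
  assumes "v \<in> V" and "C \<in> components V edges snd" and "v \<in> C"
    and closed_walk: "\<And>i t. i < m \<Longrightarrow> f t (walk s v i) \<in> walk s v ` {..<m}" and "0 < m"
  shows "C = walk s v ` {..<m}"
proof -
  note C = component_eq_class[OF assms(2,3)]
  have "x \<in> walk s v ` {..<m}" if "(v, x) \<in> (adjacency edges snd)\<^sup>*" for x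
    using that
  proof induction
    case base
    show ?case using \<open>0 < m\<close> by (metis image_eqI lessThan_iff walk.simps(1))
  next
    case (step y z)
    then show ?case using closed_walk by (auto simp: adjacency_edges)
  qed
  then show ?thesis
    using C walk_connected[OF assms(1)] walk_in_V[OF assms(1)] assms(1) by auto
qed

lemma edges_within_iff:
  assumes "C \<subseteq> V"
  shows "(t, e) \<in> edges_within edges snd C \<longleftrightarrow>
    (\<exists>x\<in>C. e = {x, f t x} \<and> f t x \<in> C \<and> f t x \<noteq> x)"
  using assms unfolding edges_within_def edges_def by auto

text \<open>Start at the end \<open>v\<close> and leave on the side other than \<open>t\<close>. The
  walk cannot close up at \<open>v\<close>, so its first repetition is a stall, which marks the
  other end of the path (\<open>v\<close> itself if it is isolated).\<close>

lemma component_is_path: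
  assumes "C \<in> components V edges snd" and "v \<in> C" and "f t v = v"
  shows "is_path edges snd C"
proof -
  have CV: "C \<subseteq> V" using assms(1) equiv_connected
    unfolding components_def by (metis Union_quotient Union_upper)
  then have v: "v \<in> V" using assms(2) by auto
  define s where "s = opp t"
  have t: "t = opp s" by (simp add: s_def)
  let ?w = "walk s v"
  obtain j m where jm: "j < m" "inj_on ?w {..<m}" "?w m = ?w j" "j = 0 \<or> Suc j = m"
    using first_return[OF v] .
  obtain n where n: "m = Suc n" using jm(1) by (cases m) auto
  have "j = n"
  proof (rule ccontr)
    assume "j \<noteq> n"
    then have j: "j = 0" "0 < n" using jm n by auto
    \<comment> \<open>Closing up at \<open>v\<close> would give \<open>?w n = v\<close> on the fixed
      side, or \<open>?w n = ?w 1\<close> on side \<open>s\<close>. The latter forces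
      \<open>n = 1\<close>, where the side is \<open>opp s\<close>.\<close>
    have "?w n = f (turn s n) v"
      using walk_back[OF v, of s n] jm(3) j n by simp
    then have "?w n = v \<or> ?w n = ?w 1 \<and> turn s n = s"
      using assms(3) t by (auto simp: turn_def)
    then have "n = 0 \<or> n = 1 \<and> turn s n = s"
      using inj_onD[OF jm(2), of n 0] inj_onD[OF jm(2), of n 1] j n by auto
    then show False using j by (auto simp: turn_def)
  qed
  then have last: "?w (Suc n) = ?w n" using jm n by simp
  have step: "f u (?w i) \<in> (if u = turn s i then {?w (Suc i)} else if i = 0 then {?w i} else {?w (i - 1)})" for u i
  proof (cases i)
    case 0
    then show ?thesis using assms(3) t neq_imp_opp[of u s] by (cases "u = s") auto
  next
    case (Suc k)
    then show ?thesis
      using step_walk_Suc[OF v, of u s k] neq_imp_opp[of u "turn s k"]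
      by (cases "u = turn s k") (simp_all add: turn_Suc del: walk.simps)
  qed
  have C: "C = ?w ` {..<m}"
  proof (rule component_eq_walk[OF v assms(1,2)])
    fix i u assume i: "i < m"
    have "\<exists>k<m. f u (?w i) = ?w k"
    proof (cases "u = turn s i")
      case True
      then show ?thesis
        using step[of u i] last i n
        by (intro exI[of _ "if i = n then n else Suc i"]) (auto simp del: walk.simps)
    next
      case False
      then show ?thesis
        using step[of u i] i less_imp_diff_less by (cases "i = 0") (auto simp del: walk.simps)
    qed
    then show "f u (?w i) \<in> ?w ` {..<m}" by auto
  qed (use n in simp)
  define es where "es = map (\<lambda>i. (turn s i, {?w i, ?w (Suc i)})) [0..<n]"
  have inj: "?w a = ?w b \<longleftrightarrow> a = b" if "a \<le> n" "b \<le> n" for a b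
    using jm(2) n that by (auto simp: inj_on_def)
  have "distinct es"
    unfolding es_def distinct_map by (auto intro!: inj_onI simp: doubleton_eq_iff inj simp del: walk.simps)
  moreover have "set es = edges_within edges snd C"
  proof (intro set_eqI iffI; clarify)
    fix u e assume "(u, e) \<in> set es"
    then obtain i where i: "i < n" "u = turn s i" "e = {?w i, ?w (Suc i)}"
      by (auto simp: es_def)
    then show "(u, e) \<in> edges_within edges snd C"
      unfolding edges_within_iff[OF CV]
      using inj[of "Suc i" i] n by (intro bexI[of _ "?w i"]) (auto simp: C simp flip: walk.simps(2))
  next
    fix u e assume "(u, e) \<in> edges_within edges snd C"
    then obtain x where "x \<in> C" "e = {x, f u x}" "f u x \<noteq> x"
      unfolding edges_within_iff[OF CV] by blast
    moreover from this(1) obtain i where "i \<le> n" "x = ?w i"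
      unfolding C n lessThan_Suc_atMost by auto
    ultimately have i: "i \<le> n" "e = {?w i, f u (?w i)}" "f u (?w i) \<noteq> ?w i"
      by simp_all
    \<comment> \<open>An edge at \<open>?w i\<close> is edge \<open>i\<close>, or edge
      \<open>i - 1\<close> read backwards; the stall at \<open>i = n\<close> gives no forward
      edge.\<close>
    show "(u, e) \<in> set es"
    proof (cases "u = turn s i")
      case True
      then have "i < n" using i last by (cases "i = n") auto
      then show ?thesis using i True by (auto simp: es_def)
    next
      case False
      then obtain k where k: "i = Suc k" using step[of u i] i by (cases i) auto
      then have u: "u = turn s k"
        using neq_imp_opp[OF False] by (simp add: turn_Suc)
      then have "f u (?w i) = ?w k"
        using k step_walk_Suc[OF v, of u s k] by (simp del: walk.simps)
      with u have "(u, e) = (turn s k, {?w k, ?w (Suc k)})" using i k by auto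
      then show ?thesis using i k by (auto simp: es_def simp del: walk.simps)
    qed
  qed
  moreover have "distinct (map ?w [0..<m])" "set (map ?w [0..<m]) = C"
    using jm(2) C by (auto simp: distinct_map lessThan_atLeast0)
  moreover have "\<forall>i<length es. snd (es ! i) = {map ?w [0..<m] ! i, map ?w [0..<m] ! (i + 1)}"
    using n by (auto simp: es_def simp del: upt_Suc)
  moreover have "length (map ?w [0..<m]) = length es + 1"
    by (simp add: es_def n)
  ultimately show ?thesis unfolding is_path_def by blast
qed

text \<open>Without fixed points the walk never stalls, so its first repetition is a return to the
  start.\<close>

lemma component_is_cycle:
  assumes "C \<in> components V edges snd" and no_fixed: "\<And>x t. x \<in> C \<Longrightarrow> f t x \<noteq> x"
  shows "is_cycle edges snd C"
proof -
  have CV: "C \<subseteq> V" using assms(1) equiv_connected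
    unfolding components_def by (metis Union_quotient Union_upper)
  obtain v where vC: "v \<in> C"
    using assms(1) equiv_connected unfolding components_def
    by (metis equiv_class_self insert_absorb insert_not_empty quotientE)
  then have v: "v \<in> V" using CV by auto
  let ?s = Upper
  let ?w = "walk ?s v"
  obtain j m where jm: "j < m" "inj_on ?w {..<m}" "?w m = ?w j" "j = 0 \<or> Suc j = m"
    using first_return[OF v] .
  have wC: "?w i \<in> C" for i
    using walk_connected[OF v, of ?s i] walk_in_V[OF v] v component_eq_class[OF assms(1) vC] by auto
  obtain n where n: "m = Suc n" using jm(1) by (cases m) auto
  have "j \<noteq> n" using jm(3) n no_fixed[OF wC[of n]] by auto
  then have j: "j = 0" "0 < n" using jm n by auto
  have last: "?w (Suc n) = v" using jm j n by simp
  have wn: "?w n = f (turn ?s n) v"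
    using walk_back[OF v, of ?s n] last by simp
  have tn: "turn ?s n = opp ?s"
  proof (rule ccontr)
    assume "turn ?s n \<noteq> opp ?s"
    then have t: "turn ?s n = ?s" by (metis neq_imp_opp opp_opp)
    then have "?w n = ?w 1" using wn by simp
    then have "n = 1" using inj_onD[OF jm(2), of n 1] j n by auto
    then show False using t by (simp add: turn_def)
  qed
  have step: "f u (?w i) = (if u = turn ?s i then ?w (Suc i) else if i = 0 then ?w n else ?w (i - 1))" for u i
  proof (cases i)
    case 0
    then show ?thesis using wn tn neq_imp_opp[of u ?s] by (cases "u = ?s") auto
  next
    case (Suc k)
    then show ?thesis
      using step_walk_Suc[OF v, of u ?s k] neq_imp_opp[of u "turn ?s k"]
      by (cases "u = turn ?s k") (simp_all add: turn_Suc del: walk.simps)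
  qed
  have C: "C = ?w ` {..<m}"
  proof (rule component_eq_walk[OF v assms(1) vC])
    fix i u assume i: "i < m"
    have "\<exists>k<m. f u (?w i) = ?w k"
    proof (cases "u = turn ?s i")
      case True
      then show ?thesis
        using step[of u i] last i n walk.simps(1)[of ?s v, symmetric]
        by (intro exI[of _ "if i = n then 0 else Suc i"]) (auto simp del: walk.simps)
    next
      case False
      then show ?thesis
        using step[of u i] i n less_imp_diff_less by (cases "i = 0") (auto simp del: walk.simps)
    qed
    then show "f u (?w i) \<in> ?w ` {..<m}" by auto
  qed (use n in simp)
  define es where "es = map (\<lambda>i. (turn ?s i, {?w i, ?w (Suc i)})) [0..<m]"
  have inj: "?w a = ?w b \<longleftrightarrow> a = b" if "a \<le> n" "b \<le> n" for a b
    using jm(2) n that by (auto simp: inj_on_def)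
  have wSuc: "?w (Suc i) = ?w (Suc i mod m)" if "i < m" for i
    using that last n by (cases "i = n") auto
  have "distinct es"
    unfolding es_def distinct_map
  proof (intro conjI inj_onI distinct_upt)
    fix a b assume ab: "a \<in> set [0..<m]" "b \<in> set [0..<m]"
      and eq: "(turn ?s a, {?w a, ?w (Suc a)}) = (turn ?s b, {?w b, ?w (Suc b)})"
    have le: "a \<le> n" "b \<le> n" "Suc a mod m \<le> n" "Suc b mod m \<le> n"
      using ab n by auto
    \<comment> \<open>Different positions with the same two ends would each be the cyclic successor
      of the other. Consecutive steps are on different sides, also across the closing step by
      \<open>tn\<close>, so the edge names differ.\<close>
    show "a = b"
    proof (rule ccontr)
      assume "a \<noteq> b"
      then have "?w a = ?w (Suc b mod m)" "?w b = ?w (Suc a mod m)"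
        using eq le ab wSuc[of a] wSuc[of b] by (auto simp: doubleton_eq_iff inj simp del: walk.simps)
      then have "a = Suc b mod m" "b = Suc a mod m"
        using le by (simp_all only: inj)
      moreover have "turn ?s a = turn ?s b" using eq by simp
      moreover have "turn ?s n = opp (turn ?s 0)" using tn by simp
      ultimately show False
        using ab n by (auto simp: mod_Suc turn_Suc split: if_splits)
    qed
  qed
  moreover have "set es = edges_within edges snd C"
  proof (intro set_eqI iffI; clarify)
    fix u e assume "(u, e) \<in> set es"
    then obtain i where i: "i < m" "u = turn ?s i" "e = {?w i, ?w (Suc i)}"
      by (auto simp: es_def)
    then show "(u, e) \<in> edges_within edges snd C"
      unfolding edges_within_iff[OF CV]
      using no_fixed[OF wC[of i]] wC[of i] wC[of "Suc i"] by (intro bexI[of _ "?w i"]) auto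
  next
    fix u e assume "(u, e) \<in> edges_within edges snd C"
    then obtain i where i: "i < m" "e = {?w i, f u (?w i)}" 
      unfolding edges_within_iff[OF CV] by (auto simp: C)
    show "(u, e) \<in> set es"
    proof (cases "u = turn ?s i")
      case True
      then show ?thesis using i by (auto simp: es_def)
    next
      case False
      \<comment> \<open>The cyclic predecessor of \<open>i\<close>: at \<open>i = 0\<close> the edge
        to find is the closing one.\<close>
      define k where "k = (if i = 0 then n else i - 1)"
      have "u = turn ?s k"
        using neq_imp_opp[OF False] tn by (cases i) (auto simp: k_def turn_Suc)
      moreover have "f u (?w i) = ?w k" "?w i = ?w (Suc k)"
        using False step[of u i] last by (auto simp: k_def simp del: walk.simps(2))
      ultimately have "(u, e) = (turn ?s k, {?w k, ?w (Suc k)})" using i by auto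
      moreover have "k < m" using i n by (auto simp: k_def)
      ultimately show ?thesis by (auto simp: es_def simp del: walk.simps)
    qed
  qed
  moreover have "distinct (map ?w [0..<m])" "set (map ?w [0..<m]) = C"
    using jm(2) C by (auto simp: distinct_map lessThan_atLeast0)
  moreover have "\<forall>i<length es. snd (es ! i) =
      {map ?w [0..<m] ! i, map ?w [0..<m] ! ((i + 1) mod length (map ?w [0..<m]))}"
    using n wSuc by (auto simp: es_def simp del: upt_Suc walk.simps)
  moreover have "length (map ?w [0..<m]) = length es" "map ?w [0..<m] \<noteq> []"
    by (simp_all add: es_def n)
  ultimately show ?thesis unfolding is_cycle_def by blast
qed

end

section \<open>Euler count over the components\<close>

lemma UNIV_side: "UNIV = {Upper, Lower}"
  using side.exhaust by auto

lemma is_path_card: "is_path E ends C \<Longrightarrow> card C = card (edges_within E ends C) + 1"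
  unfolding is_path_def by (metis distinct_card)

lemma is_cycle_card: "is_cycle E ends C \<Longrightarrow> card C = card (edges_within E ends C)"
  unfolding is_cycle_def by (metis distinct_card)

context two_involutions
begin

text \<open>A path has one vertex more than edges, a cycle equally many; the two counts also show
  that no component is both.\<close>

lemma component_euler:
  assumes "C \<in> components V edges snd"
  shows "2 * of_bool (is_cycle edges snd C) + of_bool (is_path edges snd C) + card C =
    2 + card (edges_within edges snd C)"
proof (cases "\<exists>v\<in>C. \<exists>t. f t v = v")
  case True
  then have "is_path edges snd C"
    using component_is_path[OF assms] by blast
  moreover from this have "\<not> is_cycle edges snd C"
    using is_path_card[of edges snd C] is_cycle_card[of edges snd C] by auto
  ultimately show ?thesis
    using is_path_card[of edges snd C] by simp
next
  case False
  then have "is_cycle edges snd C"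
    using component_is_cycle[OF assms] by blast
  moreover from this have "\<not> is_path edges snd C"
    using is_path_card[of edges snd C] is_cycle_card[of edges snd C] by auto
  ultimately show ?thesis
    using is_cycle_card[of edges snd C] by simp
qed

lemma finite_edges: "finite edges"
proof -
  have "edges \<subseteq> UNIV \<times> Pow V"
    unfolding edges_def using closed by auto
  moreover have "finite (UNIV \<times> Pow V :: (side \<times> 'v set) set)"
    using finite_V by (simp add: UNIV_side)
  ultimately show ?thesis
    by (rule finite_subset)
qed

text \<open>\<open>component_euler\<close> summed over the components, which partition both the
  vertices and the edges.\<close>

lemma index_euler:
  "2 * card {C \<in> components V edges snd. is_cycle edges snd C} +
   card {C \<in> components V edges snd. is_path edges snd C} + card V =
   2 * card (components V edges snd) + card edges"
proof -
  let ?S = "components V edges snd"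
  have Un: "\<Union>?S = V"
    unfolding components_def by (rule Union_quotient[OF equiv_connected])
  have disj: "C \<inter> D = {}" if "C \<in> ?S" "D \<in> ?S" "C \<noteq> D" for C D
    using that quotient_disj[OF equiv_connected] unfolding components_def by blast
  have fin: "finite ?S"
    unfolding components_def using finite_V by (simp add: quotient_def)
  have finC: "finite C" if "C \<in> ?S" for C
    using that Un finite_V finite_subset[of C V] by blast
  have cardV: "card V = (\<Sum>C\<in>?S. card C)"
    using card_Union_disjoint[of ?S] Un disj finC by (auto simp: pairwise_def disjnt_def)
  have "edges = (\<Union>C\<in>?S. edges_within edges snd C)"
  proof (intro set_eqI iffI)
    fix e assume "e \<in> edges"
    then obtain s x where e: "e = (s, {x, f s x})" "x \<in> V" by (auto simp: edges_def)
    obtain C where C: "C \<in> ?S" "x \<in> C" using Un e by blast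
    have "f s x \<in> C"
      unfolding component_eq_class[OF C] using step_connected[OF e(2)] closed e(2) by auto
    then show "e \<in> (\<Union>C\<in>?S. edges_within edges snd C)"
      using C e \<open>e \<in> edges\<close> by (auto simp: edges_within_def)
  qed (auto simp: edges_within_def)
  then have "card edges = card (\<Union>C\<in>?S. edges_within edges snd C)"
    by (rule arg_cong)
  also have "\<dots> = (\<Sum>C\<in>?S. card (edges_within edges snd C))"
  proof (intro card_UN_disjoint ballI impI)
    fix C D assume "C \<in> ?S" "D \<in> ?S" "C \<noteq> D"
    then have "C \<inter> D = {}" by (rule disj)
    then show "edges_within edges snd C \<inter> edges_within edges snd D = {}"
      by (auto simp: edges_within_def edges_def)
  qed (use fin finite_edges in \<open>auto simp: edges_within_def\<close>)
  finally have cardE: "card edges = (\<Sum>C\<in>?S. card (edges_within edges snd C))" .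
  have filt: "card {C \<in> ?S. P C} = (\<Sum>C\<in>?S. of_bool (P C))" for P
    using fin by (simp add: Int_def)
  have "(\<Sum>C\<in>?S. 2 * of_bool (is_cycle edges snd C) + of_bool (is_path edges snd C) + card C) =
      (\<Sum>C\<in>?S. 2 + card (edges_within edges snd C))"
    by (rule sum.cong[OF refl component_euler])
  then show ?thesis
    unfolding filt cardV cardE sum.distrib sum_distrib_left by simp
qed

end

section \<open>Arcs as reflections of blocks\<close>

text \<open>
  The involution of the arcs of \<open>xs\<close>, with the blocks placed from \<open>p + 1\<close> on, so that removing the
  first block needs no renumbering. Values at \<open>x \<le> p\<close> are meaningless.
\<close>

fun reflect :: "nat \<Rightarrow> nat list \<Rightarrow> nat \<Rightarrow> nat" where
  "reflect p [] x = x"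
| "reflect p (a # xs) x = (if x \<le> p + a then 2 * p + a + 1 - x else reflect (p + a) xs x)"

lemma reflect_in:
  "x \<in> {p<..p + sum_list xs} \<Longrightarrow> reflect p xs x \<in> {p<..p + sum_list xs}"
proof (induction p xs x rule: reflect.induct)
  case (2 p a xs x)
  then show ?case by (cases "x \<le> p + a") (auto simp: add.assoc)
qed simp

lemma reflect_gt: "p < x \<Longrightarrow> p < reflect p xs x"
proof (induction p xs x rule: reflect.induct)
  case (2 p a xs x)
  then show ?case by (cases "x \<le> p + a") auto
qed simp

lemma reflect_reflect: "p < x \<Longrightarrow> reflect p xs (reflect p xs x) = x"
proof (induction p xs x rule: reflect.induct)
  case (2 p a xs x)
  then show ?case using reflect_gt[of "p + a" x xs] by (cases "x \<le> p + a") auto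
qed simp

definition reflect_arcs :: "nat \<Rightarrow> nat list \<Rightarrow> nat set set" where
  "reflect_arcs p xs =
     {{x, reflect p xs x} | x. x \<in> {p<..p + sum_list xs} \<and> reflect p xs x \<noteq> x}"

lemma reflect_arcs_Cons:
  "reflect_arcs p (a # xs) =
     (\<lambda>i. {p + i, p + a + 1 - i}) ` {1..a div 2} \<union> reflect_arcs (p + a) xs"
proof (intro set_eqI iffI)
  fix e assume "e \<in> reflect_arcs p (a # xs)"
  then obtain x where x: "e = {x, reflect p (a # xs) x}" "p < x" "x \<le> p + a + sum_list xs"
    "reflect p (a # xs) x \<noteq> x"
    by (auto simp: reflect_arcs_def)
  show "e \<in> (\<lambda>i. {p + i, p + a + 1 - i}) ` {1..a div 2} \<union> reflect_arcs (p + a) xs"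
  proof (cases "x \<le> p + a")
    case True
    \<comment> \<open>The arc is named by its left end, and \<open>i\<close> is the position of that
      end in the block.\<close>
    define i where "i = (if x - p \<le> a div 2 then x - p else p + a + 1 - x)"
    have "e = {p + i, p + a + 1 - i}" "1 \<le> i" "i \<le> a div 2"
      using x True by (auto simp: i_def insert_commute)
    then show ?thesis by auto
  next
    case False
    then show ?thesis using x by (auto simp: reflect_arcs_def)
  qed
next
  fix e assume "e \<in> (\<lambda>i. {p + i, p + a + 1 - i}) ` {1..a div 2} \<union> reflect_arcs (p + a) xs"
  then show "e \<in> reflect_arcs p (a # xs)"
  proof
    assume "e \<in> (\<lambda>i. {p + i, p + a + 1 - i}) ` {1..a div 2}"
    then obtain i where i: "e = {p + i, p + a + 1 - i}" "1 \<le> i" "i \<le> a div 2" by auto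
    then show ?thesis
      unfolding reflect_arcs_def by (intro CollectI exI[of _ "p + i"]) auto
  next
    assume "e \<in> reflect_arcs (p + a) xs"
    then obtain x where x: "e = {x, reflect (p + a) xs x}" "p + a < x" "x \<le> p + a + sum_list xs"
      "reflect (p + a) xs x \<noteq> x"
      by (auto simp: reflect_arcs_def)
    then show ?thesis
      unfolding reflect_arcs_def by (intro CollectI exI[of _ x]) auto
  qed
qed

text \<open>The offset \<open>p\<close> is general because stripping the first block shifts the rest
  by its size.\<close>

lemma arcs_at_eq_reflect_arcs:
  "{{p + q + i, p + q + a + 1 - i} | q a i.
     \<exists>j < length xs. q = sum_list (take j xs) \<and> a = xs ! j \<and> 1 \<le> i \<and> i \<le> a div 2} =
   reflect_arcs p xs"
  (is "?A p xs = _")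
proof (induction xs arbitrary: p)
  case Nil
  show ?case by (simp add: reflect_arcs_def)
next
  case (Cons b xs)
  \<comment> \<open>As a union over \<open>j\<close>, the set lets the first block be split off as
    the term \<open>j = 0\<close>.\<close>
  have A: "?A p xs = (\<Union>j<length xs. (\<lambda>i. {p + sum_list (take j xs) + i,
      p + sum_list (take j xs) + xs ! j + 1 - i}) ` {1..xs ! j div 2})" for p xs
    unfolding set_eq_iff UN_iff image_iff Bex_def mem_Collect_eq lessThan_iff atLeastAtMost_iff
    by blast
  have "?A p (b # xs) = (\<lambda>i. {p + i, p + b + 1 - i}) ` {1..b div 2} \<union> ?A (p + b) xs"
    unfolding A unfolding length_Cons lessThan_Suc_eq_insert_0 by (simp add: image_image add.assoc)
  then show ?case
    unfolding Cons.IH reflect_arcs_Cons .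
qed

lemma arcs_eq_reflect_arcs: "arcs xs = reflect_arcs 0 xs"
  using arcs_at_eq_reflect_arcs[of 0 xs] by (simp add: arcs_def)

lemma finite_reflect_arcs: "finite (reflect_arcs p xs)"
  by (induction xs arbitrary: p) (simp_all add: reflect_arcs_Cons, simp add: reflect_arcs_def)

lemma card_reflect_arcs: "card (reflect_arcs p xs) = (\<Sum>a\<leftarrow>xs. a div 2)"
proof (induction xs arbitrary: p)
  case Nil
  show ?case by (simp add: reflect_arcs_def)
next
  case (Cons a xs)
  let ?I = "(\<lambda>i. {p + i, p + a + 1 - i}) ` {1..a div 2}"
  have "card ?I = a div 2"
    by (subst card_image) (auto intro!: inj_onI simp: doubleton_eq_iff)
  moreover have "?I \<inter> reflect_arcs (p + a) xs = {}"
    by (auto simp: reflect_arcs_def doubleton_eq_iff)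
  ultimately show ?case
    unfolding reflect_arcs_Cons
    by (subst card_Un_disjoint) (simp_all add: finite_reflect_arcs Cons.IH)
qed

section \<open>Folding leftmost blocks\<close>

definition num_classes :: "'v set \<Rightarrow> ('v \<times> 'v) set \<Rightarrow> nat" where
  "num_classes V r = card (V // (r\<^sup>* \<inter> V \<times> V))"

text \<open>\<open>\<rho>\<close> moves each vertex within its class and carries connections in
  \<open>r\<close> to connections in \<open>r'\<close>. So both relations agree on \<open>W\<close>,
  every class of \<open>r\<close> meets \<open>W\<close>, and saturating the classes of
  \<open>r'\<close> is a bijection.\<close>

lemma num_classes_retract:
  assumes sym: "sym r" "sym r'" and "W \<subseteq> V" and "r \<subseteq> V \<times> V"
    and into: "\<And>x. x \<in> V \<Longrightarrow> \<rho> x \<in> W" and id: "\<And>x. x \<in> W \<Longrightarrow> \<rho> x = x"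
    and conn: "\<And>x. x \<in> V \<Longrightarrow> (x, \<rho> x) \<in> r\<^sup>*"
    and step: "\<And>x y. (x, y) \<in> r \<Longrightarrow> (\<rho> x, \<rho> y) \<in> r'\<^sup>*"
    and "r' \<subseteq> r\<^sup>*"
  shows "num_classes V r = num_classes W r'"
proof -
  let ?R = "r\<^sup>* \<inter> V \<times> V" and ?R' = "r'\<^sup>* \<inter> W \<times> W"
  have map: "(\<rho> x, \<rho> y) \<in> r'\<^sup>*" if "(x, y) \<in> r\<^sup>*" for x y
    using that by induction (auto intro: rtrancl_trans step)
  have key: "(x, y) \<in> ?R \<longleftrightarrow> (x, y) \<in> ?R'" if "x \<in> W" "y \<in> W" for x y
    using that map[of x y] id \<open>W \<subseteq> V\<close> rtrancl_subset_rtrancl[OF \<open>r' \<subseteq> r\<^sup>*\<close>] by auto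
  note eq = equiv_rtrancl[OF sym(1), of V] and eq' = equiv_rtrancl[OF sym(2), of W]
  have ext: "?R `` (?R' `` {x}) = ?R `` {x}" if "x \<in> W" for x
  proof
    show "?R `` {x} \<subseteq> ?R `` (?R' `` {x})" using that by auto
    show "?R `` (?R' `` {x}) \<subseteq> ?R `` {x}"
      using key[OF that] eq by (auto intro: rtrancl_trans)
  qed
  have "bij_betw ((``) ?R) (W // ?R') (V // ?R)"
  proof (rule bij_betwI')
    fix C D assume "C \<in> W // ?R'" "D \<in> W // ?R'"
    then obtain x y where xy: "x \<in> W" "y \<in> W" "C = ?R' `` {x}" "D = ?R' `` {y}"
      by (auto elim!: quotientE)
    show "(?R `` C = ?R `` D) = (C = D)"
      unfolding xy(3,4) ext[OF xy(1)] ext[OF xy(2)]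
      using eq_equiv_class_iff[OF eq, of x y] eq_equiv_class_iff[OF eq', of x y] key[OF xy(1,2)]
        xy(1,2) \<open>W \<subseteq> V\<close> by blast
  next
    fix C assume "C \<in> W // ?R'"
    then show "?R `` C \<in> V // ?R"
      using ext \<open>W \<subseteq> V\<close> by (auto elim!: quotientE intro!: quotientI)
  next
    fix D assume "D \<in> V // ?R"
    then obtain x where x: "x \<in> V" "D = ?R `` {x}" by (auto elim!: quotientE)
    have "(x, \<rho> x) \<in> ?R" using x conn into \<open>W \<subseteq> V\<close> by auto
    then have "D = ?R `` {\<rho> x}" unfolding x(2) by (rule equiv_class_eq[OF eq])
    then show "\<exists>C\<in>W // ?R'. D = ?R `` C"
      using ext[OF into[OF x(1)]] quotientI[OF into[OF x(1)], of ?R'] by metis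
  qed
  then show ?thesis
    unfolding num_classes_def by (rule bij_betw_same_card[symmetric])
qed

lemma num_classes_isolated:
  assumes "A \<inter> W = {}" "r \<subseteq> W \<times> W" "finite A" "finite W"
  shows "num_classes (A \<union> W) r = card A + num_classes W r"
proof -
  have in_W: "(x, y) \<in> r\<^sup>* \<Longrightarrow> x = y \<or> x \<in> W \<and> y \<in> W" for x y
    by (induction rule: rtrancl_induct) (use assms in auto)
  let ?R = "r\<^sup>* \<inter> (A \<union> W) \<times> (A \<union> W)" and ?R' = "r\<^sup>* \<inter> W \<times> W"
  have "?R `` {x} = {x}" if "x \<in> A" for x
    using that in_W assms by auto
  moreover have "?R `` {x} = ?R' `` {x}" if "x \<in> W" for x
    using that in_W assms by auto
  ultimately have "(A \<union> W) // ?R = (\<lambda>x. {x}) ` A \<union> W // ?R'"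
    unfolding quotient_def by auto
  moreover have "card ((\<lambda>x. {x}) ` A) = card A"
    by (rule card_image) auto
  moreover have "(\<lambda>x. {x}) ` A \<inter> W // ?R' = {}"
    using assms(1) by (auto simp: quotient_def)
  moreover have "finite (W // ?R')"
    using assms by (simp add: quotient_def)
  ultimately show ?thesis
    unfolding num_classes_def using assms by (simp add: card_Un_disjoint)
qed

section \<open>Connectivity of meanders and the two reductions\<close>

definition meander_rel :: "nat \<Rightarrow> nat list \<Rightarrow> nat list \<Rightarrow> (nat \<times> nat) set" where
  "meander_rel p l m =
     {(x, y). x \<in> {p<..p + sum_list l} \<and> (y = reflect p l x \<or> y = reflect p m x)}"

definition num_comps :: "nat \<Rightarrow> nat list \<Rightarrow> nat list \<Rightarrow> nat" where
  "num_comps p l m = num_classes {p<..p + sum_list l} (meander_rel p l m)"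

lemma meander_rel_in:
  assumes "sum_list l = sum_list m"
  shows "meander_rel p l m \<subseteq> {p<..p + sum_list l} \<times> {p<..p + sum_list l}"
proof
  fix z assume "z \<in> meander_rel p l m"
  then obtain x y where "z = (x, y)" "x \<in> {p<..p + sum_list l}" "y = reflect p l x \<or> y = reflect p m x"
    by (auto simp: meander_rel_def)
  then show "z \<in> {p<..p + sum_list l} \<times> {p<..p + sum_list l}"
    using reflect_in[of x p l] reflect_in[of x p m] assms by auto
qed

lemma sym_meander_rel:
  assumes "sum_list l = sum_list m"
  shows "sym (meander_rel p l m)"
proof (rule symI)
  fix x y assume xy: "(x, y) \<in> meander_rel p l m"
  then have "p < x" "y = reflect p l x \<or> y = reflect p m x"
    by (auto simp: meander_rel_def)
  then have "x = reflect p l y \<or> x = reflect p m y"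
    by (auto simp: reflect_reflect)
  moreover have "y \<in> {p<..p + sum_list l}"
    using xy meander_rel_in[OF assms] by blast
  ultimately show "(y, x) \<in> meander_rel p l m"
    unfolding meander_rel_def by blast
qed

lemma num_comps_commute:
  assumes "sum_list l = sum_list m"
  shows "num_comps p l m = num_comps p m l"
proof -
  have "meander_rel p l m = meander_rel p m l"
    using assms by (auto simp: meander_rel_def)
  then show ?thesis
    using assms by (simp add: num_comps_def)
qed

text \<open>Equal first blocks have the same arcs and are cut off from the rest.
  \<open>\<rho>\<close> sends each of their vertices to the left end of its arc; the
  \<open>(a + 1) div 2\<close> images, with the middle vertex if \<open>a\<close> is odd, become
  isolated.\<close>

lemma num_comps_same:
  assumes sums: "sum_list l = sum_list m"
  shows "num_comps p (a # l) (a # m) = (a + 1) div 2 + num_comps (p + a) l m"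
proof -
  define \<rho> where "\<rho> x = (if x \<le> p + a then min x (2 * p + a + 1 - x) else x)" for x
  let ?A = "{p<..p + (a + 1) div 2}" and ?W = "{p + a<..p + a + sum_list l}"
  let ?r = "meander_rel p (a # l) (a # m)" and ?r' = "meander_rel (p + a) l m"
  have "num_comps p (a # l) (a # m) = num_classes (?A \<union> ?W) ?r'"
    unfolding num_comps_def
  proof (rule num_classes_retract[where \<rho> = \<rho>])
    show "sym ?r" "sym ?r'"
      using sums by (auto intro!: sym_meander_rel)
    show "?r \<subseteq> {p<..p + sum_list (a # l)} \<times> {p<..p + sum_list (a # l)}"
      using sums by (intro meander_rel_in) auto
    show "?A \<union> ?W \<subseteq> {p<..p + sum_list (a # l)}"
      by auto
    show "\<rho> x \<in> ?A \<union> ?W" if "x \<in> {p<..p + sum_list (a # l)}" for x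
      using that by (auto simp: \<rho>_def min_def)
    show "\<rho> x = x" if "x \<in> ?A \<union> ?W" for x
      using that by (auto simp: \<rho>_def min_def)
    show "(x, \<rho> x) \<in> ?r\<^sup>*" if "x \<in> {p<..p + sum_list (a # l)}" for x
    proof (cases "\<rho> x = x")
      case False
      then have "(x, \<rho> x) \<in> ?r"
        using that by (auto simp: \<rho>_def meander_rel_def min_def split: if_splits)
      then show ?thesis ..
    qed simp
    show "(\<rho> x, \<rho> y) \<in> ?r'\<^sup>*" if "(x, y) \<in> ?r" for x y
    proof (cases "x \<le> p + a")
      case True
      then have "\<rho> x = \<rho> y"
        using that by (auto simp: \<rho>_def meander_rel_def min_def)
      then show ?thesis by simp
    next
      case False
      then have "(x, y) \<in> ?r'"
        using that by (auto simp: meander_rel_def)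
      moreover from this have "\<rho> x = x" "\<rho> y = y"
        using meander_rel_in[OF sums, of "p + a"] by (auto simp: \<rho>_def)
      ultimately show ?thesis by auto
    qed
    have "?r' \<subseteq> ?r"
      by (auto simp: meander_rel_def)
    then show "?r' \<subseteq> ?r\<^sup>*"
      by auto
  qed
  also have "\<dots> = card ?A + num_classes ?W ?r'"
    using meander_rel_in[OF sums] by (intro num_classes_isolated) auto
  finally show ?thesis
    by (simp add: num_comps_def)
qed

text \<open>The arcs of the block \<open>2 * a\<close> exchange its two halves, and
  \<open>\<rho>\<close> contracts them onto the right half. Conjugated by this exchange, the
  reflection of the block \<open>a\<close> becomes that of a block of size \<open>a\<close> on the
  right half.\<close>

lemma num_comps_double:
  assumes sums: "sum_list l = a + sum_list m"
  shows "num_comps p (a # l) (2 * a # m) = num_comps (p + a) l (a # m)"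
  unfolding num_comps_def
proof (rule num_classes_retract
    [where \<rho> = "\<lambda>x. if x \<le> p + a then 2 * p + 2 * a + 1 - x else x"])
  let ?\<rho> = "\<lambda>x. if x \<le> p + a then 2 * p + 2 * a + 1 - x else x"
  let ?V = "{p<..p + sum_list (a # l)}" and ?W = "{p + a<..p + a + sum_list l}"
  let ?r = "meander_rel p (a # l) (2 * a # m)" and ?r' = "meander_rel (p + a) l (a # m)"
  show sym_r: "sym ?r" and "sym ?r'"
    using sums by (auto intro!: sym_meander_rel)
  show "?r \<subseteq> ?V \<times> ?V"
    using sums by (intro meander_rel_in) auto
  show "?W \<subseteq> ?V"
    by auto
  show "?\<rho> x \<in> ?W" if "x \<in> ?V" for x
    using that sums by auto
  show "?\<rho> x = x" if "x \<in> ?W" for x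
    using that by auto
  show "(x, ?\<rho> x) \<in> ?r\<^sup>*" if "x \<in> ?V" for x
    using that by (auto simp: meander_rel_def)
  show "(?\<rho> x, ?\<rho> y) \<in> ?r'\<^sup>*" if "(x, y) \<in> ?r" for x y
  proof -
    have x: "p < x" "x \<le> p + a + sum_list l"
      and y: "y = reflect p (a # l) x \<or> y = reflect p (2 * a # m) x"
      using that by (auto simp: meander_rel_def)
    consider "x \<le> p + a" | "p + a < x" "x \<le> p + 2 * a" | "p + 2 * a < x"
      by linarith
    then show ?thesis
    proof cases
      case 1
      then have "?\<rho> y = ?\<rho> x \<or> ?\<rho> y = reflect (p + a) (a # m) (?\<rho> x)"
        using x y by auto
      moreover have "?\<rho> x \<in> ?W"
        using x 1 sums by auto
      ultimately show ?thesis
        by (auto simp: meander_rel_def simp del: reflect.simps)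
    next
      case 2
      then have "y = reflect (p + a) l x \<or> ?\<rho> y = ?\<rho> x"
        using x y by auto
      then show ?thesis
        using x 2 reflect_gt[of "p + a" x l] by (auto simp: meander_rel_def)
    next
      case 3
      then have "y = reflect (p + a) l x \<or> y = reflect (p + a) (a # m) x"
        using x y by (auto simp: mult_2 add.assoc)
      then show ?thesis
        using x 3 reflect_gt[of "p + a" x l] reflect_gt[of "p + a" x "a # m"]
        by (auto simp: meander_rel_def simp del: reflect.simps)
    qed
  qed
  show "?r' \<subseteq> ?r\<^sup>*"
  proof clarify
    fix x y assume xy: "(x, y) \<in> ?r'"
    then have x: "p + a < x" "x \<le> p + a + sum_list l"
      and y: "y = reflect (p + a) l x \<or> y = reflect (p + a) (a # m) x"
      by (auto simp: meander_rel_def)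
    show "(x, y) \<in> ?r\<^sup>*"
    proof (cases "x \<le> p + 2 * a \<and> y = reflect (p + a) (a # m) x")
      case True
      then have y: "y = 2 * p + 3 * a + 1 - x" using x by auto
      \<comment> \<open>A reflection in the new block unfolds to three: through the block
        \<open>2 * a\<close> to the left half, through the block \<open>a\<close>, and back through
        \<open>2 * a\<close>.\<close>
      have "(x, 2 * p + 2 * a + 1 - x) \<in> ?r" "(2 * p + 2 * a + 1 - x, x - a) \<in> ?r"
        "(x - a, y) \<in> ?r"
        using x True y by (auto simp: meander_rel_def)
      then show ?thesis
        by (meson converse_rtrancl_into_rtrancl rtrancl.rtrancl_refl)
    next
      case False
      then have "(x, y) \<in> ?r"
        using x y by (auto simp: meander_rel_def mult_2 add.assoc)
      then show ?thesis ..
    qed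
  qed
qed

section \<open>The index for blocks of size c and 2c\<close>

text \<open>
  Equal to the index when all blocks have size \<open>c\<close> or \<open>2c\<close>. The cases \<open>a \<noteq> b\<close> are folding steps for
  a block and one of twice its size, so the larger block is replaced by one of the smaller size.
\<close>

fun block_index :: "nat list \<Rightarrow> nat list \<Rightarrow> nat" where
  "block_index (a # l) (b # m) =
     (if a = b then a + block_index l m
      else if a < b then block_index l (a # m)
      else block_index (b # l) m)"
| "block_index _ _ = 0"

text \<open>The Euler relation with \<open>block_index\<close> in place of the index, by induction
  along its recursion. Equal blocks \<open>a\<close> add \<open>2 * a\<close> to both sides; a
  folding step adds the smaller size to both sides.\<close>

lemma num_comps_block_index:
  assumes "c \<ge> 1" "set l \<subseteq> {c, 2 * c}" "set m \<subseteq> {c, 2 * c}" "sum_list l = sum_list m"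
  shows "2 * num_comps p l m + (\<Sum>a\<leftarrow>l. a div 2) + (\<Sum>a\<leftarrow>m. a div 2) =
    sum_list l + block_index l m"
  using assms(2-)
proof (induction l m arbitrary: p rule: block_index.induct)
  case (1 a l b m)
  consider "a = b" | "a = c" "b = 2 * c" | "a = 2 * c" "b = c"
    using "1.prems" by auto
  then show ?case
  proof cases
    case 1
    have "2 * ((a + 1) div 2) + 2 * (a div 2) = 2 * a" by presburger
    then show ?thesis
      using 1 "1.IH"(1)[of "p + a"] "1.prems" num_comps_same[of l m p a] by simp
  next
    case 2
    then have "2 * num_comps (p + a) l (a # m) + (\<Sum>a\<leftarrow>l. a div 2) + (\<Sum>a\<leftarrow>a # m. a div 2) =
        sum_list l + block_index l (a # m)"
      using \<open>c \<ge> 1\<close> "1.prems" by (intro "1.IH"(2)) auto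
    then show ?thesis
      using 2 \<open>c \<ge> 1\<close> "1.prems" num_comps_double[of l a m p] by simp
  next
    case 3
    then have "2 * num_comps (p + b) (b # l) m + (\<Sum>a\<leftarrow>b # l. a div 2) + (\<Sum>a\<leftarrow>m. a div 2) =
        sum_list (b # l) + block_index (b # l) m"
      using \<open>c \<ge> 1\<close> "1.prems" by (intro "1.IH"(3)) auto
    moreover have "num_comps p (a # l) (b # m) = num_comps (p + b) (b # l) m"
      using 3 "1.prems" num_comps_double[of m b l p] num_comps_commute[of "a # l" "b # m" p]
        num_comps_commute[of "b # l" m "p + b"] by simp
    ultimately show ?thesis
      using 3 \<open>c \<ge> 1\<close> "1.prems" by simp
  qed
next
  case ("2_1" m)
  \<comment> \<open>Blocks are positive and the sums agree, so both lists run out together.\<close>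
  have "m = []" using "2_1.prems" \<open>c \<ge> 1\<close> by (cases m) auto
  then show ?case by (simp add: num_comps_def num_classes_def quotient_def)
next
  case ("2_2" l)
  have "l = []" using "2_2.prems" \<open>c \<ge> 1\<close> by (cases l) auto
  then show ?case by (simp add: num_comps_def num_classes_def quotient_def)
qed

text \<open>An instance of \<open>index_euler\<close>, with the reflections of the two lists as the
  involutions.\<close>

lemma meander_index_euler:
  assumes sums: "sum_list l = sum_list m"
  shows "meander_index (l, m) + sum_list l =
    2 * num_comps 0 l m + (\<Sum>a\<leftarrow>l. a div 2) + (\<Sum>a\<leftarrow>m. a div 2)"
proof -
  define f where "f s = (case s of Upper \<Rightarrow> reflect 0 l | Lower \<Rightarrow> reflect 0 m)" for s
  let ?V = "{1..sum_list l}"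
  have V: "?V = {0<..0 + sum_list l}" by auto
  interpret two_involutions ?V f
  proof
    fix x s assume x: "x \<in> ?V"
    then show "f s x \<in> ?V"
      using reflect_in[of x 0 l] reflect_in[of x 0 m] sums by (cases s) (auto simp: f_def)
    show "f s (f s x) = x"
      using x by (cases s) (auto simp: f_def reflect_reflect)
  qed simp
  have edges: "meander_edges (l, m) = edges"
  proof -
    have "edges = (\<Union>s. {s} \<times> {{x, f s x} | x. x \<in> ?V \<and> f s x \<noteq> x})"
      unfolding edges_def by auto
    also have "\<dots> = {Upper} \<times> reflect_arcs 0 l \<union> {Lower} \<times> reflect_arcs 0 m"
      unfolding V unfolding reflect_arcs_def UNIV_side by (simp add: f_def sums)
    finally show ?thesis by (simp add: arcs_eq_reflect_arcs)
  qed
  have "adjacency edges snd = meander_rel 0 l m - Id"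
  proof -
    have "adjacency edges snd = (\<Union>s. {(u, f s u) | u. u \<in> ?V \<and> f s u \<noteq> u})"
      unfolding adjacency_edges by blast
    also have "\<dots> = meander_rel 0 l m - Id"
      unfolding V unfolding meander_rel_def UNIV_side by (auto simp: f_def)
    finally show ?thesis .
  qed
  \<comment> \<open>\<open>meander_rel\<close> has loops at fixed points, which do not change the
    reflexive transitive closure.\<close>
  then have "(adjacency edges snd)\<^sup>* = (meander_rel 0 l m)\<^sup>*"
    by (simp add: rtrancl_r_diff_Id)
  then have "card (components ?V edges snd) = num_comps 0 l m"
    unfolding components_def num_comps_def num_classes_def V by simp
  moreover have "card edges = (\<Sum>a\<leftarrow>l. a div 2) + (\<Sum>a\<leftarrow>m. a div 2)"
    unfolding edges[symmetric] meander_edges.simps arcs_eq_reflect_arcs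
    by (subst card_Un_disjoint)
      (auto simp: finite_reflect_arcs card_cartesian_product card_reflect_arcs)
  ultimately show ?thesis
    using index_euler unfolding meander_index_def meander_components_def edges by simp
qed

lemma meander_index_block_index:
  assumes "c \<ge> 1" "set l \<subseteq> {c, 2 * c}" "set m \<subseteq> {c, 2 * c}" "sum_list l = sum_list m"
  shows "meander_index (l, m) = block_index l m"
  using num_comps_block_index[OF assms, of 0] meander_index_euler[OF assms(4)] by simp

lemma block_index_commute: "block_index l m = block_index m l"
  by (induction l m rule: block_index.induct) auto

text \<open>Scaling preserves every comparison in the recursion, so only the added block sizes gain
  the factor \<open>c\<close>.\<close>

lemma block_index_scale:
  "c \<ge> 1 \<Longrightarrow> block_index (map ((*) c) l) (map ((*) c) m) = c * block_index l m"
  by (induction l m rule: block_index.induct) (auto simp: algebra_simps)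

section \<open>Generating functions\<close>

definition comps12 :: "nat \<Rightarrow> nat list set" where
  "comps12 n = {l. set l \<subseteq> {1, 2} \<and> sum_list l = n}"

lemma Cons_in_comps12:
  "x # l \<in> comps12 n \<longleftrightarrow> x = 1 \<and> 1 \<le> n \<and> l \<in> comps12 (n - 1) \<or> x = 2 \<and> 2 \<le> n \<and> l \<in> comps12 (n - 2)"
  by (auto simp: comps12_def)

lemma comps12_0: "comps12 0 = {[]}"
proof (rule set_eqI)
  show "l \<in> comps12 0 \<longleftrightarrow> l \<in> {[]}" for l
    by (cases l) (simp_all add: Cons_in_comps12, simp add: comps12_def)
qed

lemma comps12_1: "comps12 1 = {[1]}"
proof (rule set_eqI)
  show "l \<in> comps12 1 \<longleftrightarrow> l \<in> {[1]}" for l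
  proof (cases l)
    case Nil
    then show ?thesis by (simp add: comps12_def)
  next
    case (Cons x k)
    then show ?thesis unfolding Cons Cons_in_comps12 by (auto simp: comps12_0)
  qed
qed

lemma comps12_add_2: "comps12 (n + 2) = (#) 1 ` comps12 (n + 1) \<union> (#) 2 ` comps12 n"
proof (rule set_eqI)
  show "l \<in> comps12 (n + 2) \<longleftrightarrow> l \<in> (#) 1 ` comps12 (n + 1) \<union> (#) 2 ` comps12 n" for l
    by (cases l) (auto simp: Cons_in_comps12 comps12_0, auto simp: comps12_def)
qed

lemma finite_comps12: "finite (comps12 n)"
proof -
  have "finite (comps12 n) \<and> finite (comps12 (Suc n))"
  proof (induction n)
    case 0
    show ?case using comps12_0 comps12_1 by simp
  next
    case (Suc n)
    then show ?case using comps12_add_2[of n] by simp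
  qed
  then show ?thesis ..
qed

lemma sum_comps12_add_2:
  fixes h :: "nat list \<Rightarrow> 'a :: comm_monoid_add"
  shows "sum h (comps12 (n + 2)) = (\<Sum>l\<in>comps12 (n + 1). h (1 # l)) + (\<Sum>l\<in>comps12 n. h (2 # l))"
  unfolding comps12_add_2
  by (subst sum.union_disjoint) (auto simp: finite_comps12 sum.reindex)

text \<open>The coefficient of the \<open>n\<close>-th power of \<open>x\<close> in the series for
  blocks 1 and 2; \<open>fps_X\<close> is \<open>y\<close> here.\<close>

definition index_poly :: "nat \<Rightarrow> rat fps" where
  "index_poly n = (\<Sum>l\<in>comps12 n. \<Sum>m\<in>comps12 n. fps_X ^ block_index l m)"

text \<open>One block of size 1 is what a folding step leaves of a block of size 2.\<close>

definition pending_poly :: "nat \<Rightarrow> rat fps" where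
  "pending_poly n = (\<Sum>l\<in>comps12 (n + 1). \<Sum>m\<in>comps12 n. fps_X ^ block_index l (1 # m))"

section \<open>Recurrences from the first blocks\<close>

lemma index_poly_0: "index_poly 0 = 1"
  by (simp add: index_poly_def comps12_0)

lemma index_poly_1: "index_poly 1 = fps_X"
  unfolding index_poly_def comps12_1 by simp

text \<open>First blocks (1,1) and (2,2) contribute their size and disappear; (1,2) folds to a
  pending block, and (2,1) does so by symmetry.\<close>

lemma index_poly_add_2:
  "index_poly (n + 2) = fps_X * index_poly (n + 1) + fps_X ^ 2 * index_poly n + 2 * pending_poly n"
proof -
  have "(\<Sum>l\<in>comps12 n. \<Sum>m\<in>comps12 (n + 1). fps_X ^ block_index (2 # l) (1 # m)) = pending_poly n"
    unfolding pending_poly_def by (subst sum.swap) (simp add: block_index_commute)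
  then show ?thesis
    unfolding index_poly_def sum_comps12_add_2
    by (simp add: sum.distrib pending_poly_def sum_distrib_left power_add power2_eq_square algebra_simps)
qed

lemma pending_poly_0: "pending_poly 0 = fps_X * index_poly 0"
  unfolding pending_poly_def index_poly_def using comps12_1 by (simp add: comps12_0)

text \<open>Against the pending 1, a first block 1 cancels it with weight \<open>y\<close>, while a
  first block 2 folds and leaves a pending 1 on the other side.\<close>

lemma pending_poly_Suc: "pending_poly (Suc n) = fps_X * index_poly (Suc n) + pending_poly n"
proof -
  have "(\<Sum>l\<in>comps12 n. \<Sum>m\<in>comps12 (n + 1). fps_X ^ block_index (2 # l) (1 # m)) = pending_poly n"
    unfolding pending_poly_def by (subst sum.swap) (simp add: block_index_commute)
  moreover have "pending_poly (Suc n) =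
    (\<Sum>l\<in>comps12 (n + 2). \<Sum>m\<in>comps12 (n + 1). fps_X ^ block_index l (1 # m))"
    by (simp add: pending_poly_def)
  ultimately show ?thesis
    unfolding sum_comps12_add_2
    by (simp add: index_poly_def sum_distrib_left power_add)
qed

text \<open>Elimination of \<open>G\<close> without division: multiply the first equation by
  \<open>1 - x\<close> and insert \<open>(1 - x) * G = y * F\<close>.\<close>

lemma two_state_system:
  fixes F G :: "'a :: comm_ring_1"
  assumes "F = 1 + a * F + b * G" and "G = y * F + x * G"
  shows "F * ((1 - a) * (1 - x) - b * y) = 1 - x"
proof -
  have eq: "F * ((1 - a) * (1 - x) - b * y) =
      (F - (1 + a * F + b * G)) * (1 - x) + (1 - x) + b * (G - (y * F + x * G))"
    by (simp add: algebra_simps)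
  have "F - (1 + a * F + b * G) = 0" "G - (y * F + x * G) = 0"
    unfolding right_minus_eq by (fact assms)+
  then show ?thesis
    unfolding eq by (simp only: mult_zero_left mult_zero_right add_0_left add_0_right)
qed

lemma index_poly_gf:
  "Abs_fps index_poly = (1 - var_x) /
     ((1 - var_x * var_y - var_x ^ 2 * var_y ^ 2) * (1 - var_x) - 2 * var_x ^ 2 * var_y)"
proof -
  define F where "F = Abs_fps index_poly"
  define G where "G = Abs_fps pending_poly"
  \<comment> \<open>\<open>H\<close> is \<open>2 * G\<close>, written as a sum so that its
    coefficients are immediate.\<close>
  define H where "H = G + G"
  have H: "H $ k = 2 * pending_poly k" for k
    by (simp only: H_def G_def fps_add_nth fps_nth_Abs_fps mult_2)
  have "F = 1 + var_x * (var_y * F) + var_x ^ 2 * (var_y ^ 2 * F) + var_x ^ 2 * H"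
  proof (rule fps_ext)
    fix n :: nat
    have "n = 0 \<or> n = 1 \<or> (\<exists>k. n = k + 2)"
      by presburger
    then consider "n = 0" | "n = 1" | k where "n = k + 2"
      by blast
    then show "F $ n = (1 + var_x * (var_y * F) + var_x ^ 2 * (var_y ^ 2 * F) + var_x ^ 2 * H) $ n"
    proof cases
      case 1
      then show ?thesis
        by (simp add: F_def fps_X_power_mult_nth index_poly_0)
    next
      case 2
      then show ?thesis
        using index_poly_0 index_poly_1 by (simp add: F_def fps_X_power_mult_nth)
    next
      case (3 k)
      then show ?thesis
        using index_poly_add_2[of k]
        by (simp add: F_def H fps_X_power_mult_nth)
    qed
  qed
  also have "\<dots> = 1 + (var_x * var_y + var_x ^ 2 * var_y ^ 2) * F + 2 * var_x ^ 2 * G"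
    by (simp only: H_def mult.assoc distrib_right mult_2 distrib_left add.assoc)
  finally have F: "F = 1 + (var_x * var_y + var_x ^ 2 * var_y ^ 2) * F + 2 * var_x ^ 2 * G" .
  have G: "G = var_y * F + var_x * G"
  proof (rule fps_ext)
    show "G $ n = (var_y * F + var_x * G) $ n" for n
      by (cases n) (simp_all add: F_def G_def pending_poly_0 pending_poly_Suc)
  qed
  define D :: "rat fps fps" where
    "D = (1 - var_x * var_y - var_x ^ 2 * var_y ^ 2) * (1 - var_x) - 2 * var_x ^ 2 * var_y"
  have "F * D = 1 - var_x"
    using two_state_system[OF F G] by (simp only: D_def diff_diff_eq)
  \<comment> \<open>Constant term 1 makes the quotient by \<open>D\<close> genuine and gives
    \<open>D \<noteq> 0\<close>, so that \<open>D\<close> can be cancelled.\<close>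
  moreover have D0: "D $ 0 = 1"
    by (simp add: D_def)
  ultimately have "(1 - var_x) / D * D = F * D"
    using fps_fps_divide_mult_cancel[of D "1 - var_x"] by simp
  moreover have "D \<noteq> 0"
    using D0 by auto
  ultimately show ?thesis
    by (simp add: F_def D_def)
qed

section \<open>Scaling by c\<close>

lemma compositions_into_c_2c:
  assumes "c \<ge> 1"
  shows "{l \<in> compositions n. set l \<subseteq> {c, 2 * c}} =
    (if c dvd n then map ((*) c) ` comps12 (n div c) else {})"
proof -
  have into: "l \<in> map ((*) c) ` comps12 (n div c) \<and> c dvd n"
    if l: "set l \<subseteq> {c, 2 * c}" "sum_list l = n" for l
  proof -
    \<comment> \<open>All parts are \<open>c\<close> or \<open>2 * c\<close>, so the division is
      exact and multiplication by \<open>c\<close> undoes it.\<close>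
    define k where "k = map (\<lambda>a. a div c) l"
    have "map ((*) c) k = map id l"
      unfolding k_def map_map using l(1) assms by (intro map_cong refl) auto
    then have k: "l = map ((*) c) k" by simp
    have "n = c * sum_list k"
      using l(2) unfolding k by (simp add: sum_list_const_mult)
    moreover have "set k \<subseteq> {1, 2}"
      unfolding k_def using l(1) assms by auto
    ultimately show ?thesis
      using k assms by (auto simp: comps12_def)
  qed
  have onto: "map ((*) c) k \<in> compositions n \<and> set (map ((*) c) k) \<subseteq> {c, 2 * c}"
    if "c dvd n" "k \<in> comps12 (n div c)" for k
    using that assms by (auto simp: compositions_def comps12_def sum_list_const_mult)
  show ?thesis
  proof (intro set_eqI iffI)
    fix l assume "l \<in> {l \<in> compositions n. set l \<subseteq> {c, 2 * c}}"
    then show "l \<in> (if c dvd n then map ((*) c) ` comps12 (n div c) else {})"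
      using into[of l] by (simp add: compositions_def)
  next
    fix l assume "l \<in> (if c dvd n then map ((*) c) ` comps12 (n div c) else {})"
    then show "l \<in> {l \<in> compositions n. set l \<subseteq> {c, 2 * c}}"
      using onto by (auto simp del: set_map split: if_splits)
  qed
qed

text \<open>Multiplying all blocks by \<open>c\<close> is injective and reaches every pair with
  blocks \<open>c\<close> and \<open>2 * c\<close>. It multiplies both the size and
  \<open>block_index\<close> by \<open>c\<close>, so only multiples of \<open>c\<close>
  occur.\<close>

lemma meander_count_c_2c:
  assumes "c \<ge> 1"
  shows "meander_count {c, 2 * c} n k =
    (if c dvd n \<and> c dvd k
     then card {(l, m) \<in> comps12 (n div c) \<times> comps12 (n div c). block_index l m = k div c} else 0)"
proof -
  define S where "S = {l \<in> compositions n. set l \<subseteq> {c, 2 * c}}"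
  have "{(l, m) \<in> meanders n. set l \<subseteq> {c, 2 * c} \<and> set m \<subseteq> {c, 2 * c} \<and> meander_index (l, m) = k} =
      {(l, m) \<in> S \<times> S. block_index l m = k}"
    using meander_index_block_index[OF assms]
    by (auto simp: S_def meanders_def compositions_def)
  then have count: "meander_count {c, 2 * c} n k = card {(l, m) \<in> S \<times> S. block_index l m = k}"
    by (simp add: meander_count_def)
  have S: "S = (if c dvd n then map ((*) c) ` comps12 (n div c) else {})"
    unfolding S_def by (rule compositions_into_c_2c[OF assms])
  show ?thesis
  proof (cases "c dvd n")
    case False
    then show ?thesis by (simp add: count S)
  next
    case True
    let ?C = "comps12 (n div c)"
    let ?h = "map_prod (map ((*) c)) (map ((*) c))"
    have "{(l, m) \<in> S \<times> S. block_index l m = k} =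
        ?h ` {(l, m) \<in> ?C \<times> ?C. c * block_index l m = k}"
      using True assms block_index_scale[OF assms] by (auto simp: S image_iff)
    moreover have "inj ?h"
      using assms by (intro prod.inj_map list.inj_map) (auto intro!: injI)
    ultimately have "meander_count {c, 2 * c} n k =
        card {(l, m) \<in> ?C \<times> ?C. c * block_index l m = k}"
      by (simp add: count card_image inj_on_subset)
    moreover have "c * b = k \<longleftrightarrow> c dvd k \<and> b = k div c" for b
      using assms by auto
    ultimately show ?thesis
      using True by simp
  qed
qed

lemma index_poly_nth:
  "index_poly n $ k = of_nat (card {(l, m) \<in> comps12 n \<times> comps12 n. block_index l m = k})"
proof -
  have "index_poly n $ k = (\<Sum>l\<in>comps12 n. \<Sum>m\<in>comps12 n. of_bool (block_index l m = k))"
    by (simp add: index_poly_def fps_sum_nth fps_X_power_nth of_bool_def eq_commute)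
  also have "\<dots> = (\<Sum>(l, m)\<in>comps12 n \<times> comps12 n. of_bool (block_index l m = k))"
    by (rule sum.cartesian_product)
  also have "\<dots> = of_nat (card ((comps12 n \<times> comps12 n) \<inter> {z. block_index (fst z) (snd z) = k}))"
    using finite_comps12 by (simp add: case_prod_beta)
  also have "(comps12 n \<times> comps12 n) \<inter> {z. block_index (fst z) (snd z) = k} =
      {(l, m) \<in> comps12 n \<times> comps12 n. block_index l m = k}"
    by auto
  finally show ?thesis .
qed

lemma meander_count_c_2c_index_poly:
  assumes "c \<ge> 1"
  shows "rat_of_nat (meander_count {c, 2 * c} n k) =
    (if c dvd n \<and> c dvd k then index_poly (n div c) $ (k div c) else 0)"
  unfolding meander_count_c_2c[OF assms] index_poly_nth by simp

lemma meander_gf_12: "meander_gf {1, 2} = Abs_fps index_poly"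
  using meander_count_c_2c_index_poly[of 1]
  by (intro fps_ext) (simp add: meander_gf_def)

theorem theorem3p2:
  shows "meander_gf {1, 2} =
           (1 - var_x) /
           ((1 - var_x * var_y - var_x ^ 2 * var_y ^ 2) * (1 - var_x) - 2 * var_x ^ 2 * var_y)
         \<and> (\<forall>c::nat. c \<ge> 1 \<longrightarrow> meander_gf {c, 2 * c} = subst_powers c (meander_gf {1, 2}))"
proof (intro conjI allI impI)
  show "meander_gf {1, 2} = (1 - var_x) /
      ((1 - var_x * var_y - var_x ^ 2 * var_y ^ 2) * (1 - var_x) - 2 * var_x ^ 2 * var_y)"
    unfolding meander_gf_12 by (rule index_poly_gf)
  fix c :: nat assume c: "c \<ge> 1"
  \<comment> \<open>Coefficientwise, both sides vanish unless \<open>c\<close> divides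
    \<open>n\<close> and \<open>k\<close>, and otherwise equal the coefficient at the
    quotients.\<close>
  show "meander_gf {c, 2 * c} = subst_powers c (meander_gf {1, 2})"
    unfolding meander_gf_12
    by (intro fps_ext)
      (simp add: meander_gf_def subst_powers_nth[OF c] meander_count_c_2c_index_poly[OF c])
qed

end
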